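(* Let $\mathbb{F}$ be a field and let $n = dk$, where $d \geq 1$ and $k > 1$ are integers. Let $H$ be a nontrivial irreducible primitive subgroup of $\operatorname{GL}_d(\mathbb{F})$ and let $K \leq S_k$ be transitive, so that the subgroup $G = H \wr K$ of $\operatorname{GL}_n(\mathbb{F})$ is irreducible. Then $G$ has a unique nonrefinable system of imprimitivity, except when all of the following hold: $d = 1$, $n = k$ is even, $|H| = 2$, and $K$ is a subgroup of $C_2 \wr S_{n/2}$. (That is: if these four conditions do not all hold, then $G$ has exactly one nonrefinable system of imprimitivity.)
   Context: Let $V$ be a finite-dimensional vector space over a field $\mathbb{F}$ and let $G \leq \operatorname{GL}(V)$ be irreducible. A system of imprimitivity for $G$ is a set $\Gamma = \{W_1, \ldots, W_k\}$ of nonzero subspaces with $k > 1$, $V = W_1 \oplus \cdots \oplus W_k$, such that $G$ permutes the set $\Gamma$. If a system of imprimitivity exists, $G$ is imprimitive; otherwise $G$ is primitive. A system of imprimitivity $\{Z_1, \ldots, Z_\ell\}$ for $G$ is a refinement of $\Gamma$ if each $W_i$ is a direct sum of some of the $Z_j$; $\Gamma$ is nonrefinable if it has no proper refinement (i.e. no refinement different from $\Gamma$). For $H \leq \operatorname{GL}_d(\mathbb{F})$ and $K \leq S_k$, the wreath product $H \wr K = H^k \rtimes K$ is regarded as a subgroup of $\operatorname{GL}_{dk}(\mathbb{F})$ acting on $\mathbb{F}^{dk} = (\mathbb{F}^d)^k$: the $i$th factor of the base group $H^k$ acts on the $i$th summand $\mathbb{F}^d$ as $H$ and trivially on the other summands,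 and $K$ permutes the $k$ summands. "$K$ is a subgroup of $C_2 \wr S_{n/2}$" refers to $C_2 \wr S_{n/2}$ in its imprimitive action of degree $n$, up to conjugacy in $S_n$; i.e. it means that $K$ preserves some partition of $\{1, \ldots, n\}$ into $n/2$ blocks of size $2$. *)

theory Defs
  imports "HOL-Analysis.Analysis" "HOL-Algebra.Bij"
begin

text \<open>
  The space \<open>F\<^sup>d\<close> is \<^typ>\<open>'a ^ 'd\<close> over a field \<^typ>\<open>'a\<close>, with \<open>d = CARD('d)\<close>; matrices act on
  column vectors from the left.  The space \<open>F\<^sup>d\<^sup>k = (F\<^sup>d)\<^sup>k\<close> is \<^typ>\<open>'a ^ ('k \<times> 'd)\<close>: the
  coordinate with index \<open>(i, j)\<close> is the \<open>j\<close>-th coordinate in the \<open>i\<close>-th summand.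
\<close>

definition GL :: "('a::field ^ 'n ^ 'n) monoid" where
  "GL = \<lparr>carrier = {A. invertible A}, mult = (\<lambda>A B. A ** B), one = mat 1\<rparr>"

definition mat_image :: "'a::field ^ 'n ^ 'n \<Rightarrow> ('a ^ 'n) set \<Rightarrow> ('a ^ 'n) set" where
  "mat_image A W = (\<lambda>v. A *v v) ` W"

definition irreducible_group :: "('a::field ^ 'n ^ 'n) set \<Rightarrow> bool" where
  "irreducible_group G \<longleftrightarrow>
     subgroup G GL \<and>
     (\<forall>W. vec.subspace W \<and> (\<forall>A\<in>G. mat_image A W \<subseteq> W) \<longrightarrow> W = {0} \<or> W = UNIV)"

definition internal_direct_sum :: "('a::field ^ 'n) set set \<Rightarrow> ('a ^ 'n) set \<Rightarrow> bool" where
  "internal_direct_sum S U \<longleftrightarrow>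
     finite S \<and> (\<forall>W\<in>S. vec.subspace W) \<and>
     U = {\<Sum>W\<in>S. f W | f. \<forall>W\<in>S. f W \<in> W} \<and>
     (\<forall>f. (\<forall>W\<in>S. f W \<in> W) \<and> (\<Sum>W\<in>S. f W) = 0 \<longrightarrow> (\<forall>W\<in>S. f W = 0))"

definition system_of_imprimitivity ::
    "('a::field ^ 'n ^ 'n) set \<Rightarrow> ('a ^ 'n) set set \<Rightarrow> bool" where
  "system_of_imprimitivity G \<Gamma> \<longleftrightarrow>
     card \<Gamma> > 1 \<and>
     (\<forall>W\<in>\<Gamma>. vec.subspace W \<and> W \<noteq> {0}) \<and>
     internal_direct_sum \<Gamma> UNIV \<and>
     (\<forall>A\<in>G. bij_betw (mat_image A) \<Gamma> \<Gamma>)"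

definition primitive_group :: "('a::field ^ 'n ^ 'n) set \<Rightarrow> bool" where
  "primitive_group G \<longleftrightarrow> (\<nexists>\<Gamma>. system_of_imprimitivity G \<Gamma>)"

definition refinement ::
    "('a::field ^ 'n ^ 'n) set \<Rightarrow> ('a ^ 'n) set set \<Rightarrow> ('a ^ 'n) set set \<Rightarrow> bool" where
  "refinement G \<Delta> \<Gamma> \<longleftrightarrow>
     system_of_imprimitivity G \<Delta> \<and> (\<forall>W\<in>\<Gamma>. \<exists>S\<subseteq>\<Delta>. internal_direct_sum S W)"

definition nonrefinable_system ::
    "('a::field ^ 'n ^ 'n) set \<Rightarrow> ('a ^ 'n) set set \<Rightarrow> bool" where
  "nonrefinable_system G \<Gamma> \<longleftrightarrow>
     system_of_imprimitivity G \<Gamma> \<and> (\<forall>\<Delta>. refinement G \<Delta> \<Gamma> \<longrightarrow> \<Delta> = \<Gamma>)"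

definition transitive_perms :: "('k \<Rightarrow> 'k) set \<Rightarrow> bool" where
  "transitive_perms K \<longleftrightarrow> (\<forall>i j. \<exists>\<sigma>\<in>K. \<sigma> i = j)"

text \<open>The element \<open>h\<close> of the base group: \<open>h i\<close> acts on the \<open>i\<close>-th summand.\<close>

definition block_diag :: "('k::finite \<Rightarrow> 'a::field ^ 'd::finite ^ 'd) \<Rightarrow> 'a ^ ('k \<times> 'd) ^ ('k \<times> 'd)" where
  "block_diag h = (\<chi> p q. if fst p = fst q then h (fst p) $ snd p $ snd q else 0)"

text \<open>The matrix that maps the \<open>i\<close>-th summand identically onto the \<open>\<sigma> i\<close>-th one.\<close>

definition block_perm :: "('k::finite \<Rightarrow> 'k) \<Rightarrow> 'a::field ^ ('k \<times> 'd::finite) ^ ('k \<times> 'd)" where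
  "block_perm \<sigma> = (\<chi> p q. if p = (\<sigma> (fst q), snd q) then 1 else 0)"

definition wreath ::
    "('a::field ^ 'd ^ 'd) set \<Rightarrow> ('k::finite \<Rightarrow> 'k) set \<Rightarrow> ('a ^ ('k \<times> 'd) ^ ('k \<times> 'd)) set" where
  "wreath H K = {block_diag h ** block_perm \<sigma> | h \<sigma>. (\<forall>i. h i \<in> H) \<and> \<sigma> \<in> K}"

text \<open>
  \<open>K\<close> lies in a conjugate of the wreath product of \<open>C\<^sub>2\<close> with \<open>S\<^bsub>k/2\<^esub>\<close>, in its imprimitive action
  of degree \<open>k\<close>.
\<close>

definition preserves_pairing :: "('k::finite \<Rightarrow> 'k) set \<Rightarrow> bool" where
  "preserves_pairing K \<longleftrightarrow>
     (\<exists>P. partition_on (UNIV :: 'k set) P \<and> card P = CARD('k) div 2 \<and> (\<forall>B\<in>P. card B = 2) \<and>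
          (\<forall>\<sigma>\<in>K. \<forall>B\<in>P. \<sigma> ` B \<in> P))"

end

theory Submission
  imports Defs
begin

text \<open>
  Write \<open>V\<^sub>i\<close> for the \<open>i\<close>-th summand and \<open>B\<^sub>i\<close> for the \<open>i\<close>-th factor of the base group; the candidate
  for the unique nonrefinable system is \<open>{V\<^sub>1, \<dots>, V\<^sub>k}\<close>, and it suffices that it refines every system
  \<open>\<Gamma>\<close>.  If every \<open>B\<^sub>i\<close> stabilises every member of \<open>\<Gamma>\<close>, then some member \<open>W\<close> contains a nonzero
  vector \<open>(h - 1) w \<in> V\<^sub>i\<close>, hence \<open>V\<^sub>i\<close>, and the claim follows.

  Now let \<open>h \<in> B\<^sub>i\<close> move \<open>W \<in> \<Gamma>\<close>.  For \<open>j \<noteq> i\<close> and \<open>b \<in> B\<^sub>j\<close> the identity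
  \<open>(h - 1) (b - 1) = 0\<close> shows that either \<open>b\<close> fixes \<open>W\<close> pointwise, or \<open>h\<close> and \<open>b\<close> move \<open>W\<close> to the
  same subspace and \<open>h w = - b w\<close> on \<open>W\<close>.  If the first alternative always held, then \<open>W\<close> would lie
  in \<open>V\<^sub>i\<close> and its \<open>B\<^sub>i\<close>-orbit would contradict the primitivity of \<open>H\<close>.  The second one puts \<open>W\<close> into
  some \<open>V\<^sub>i \<oplus> V\<^sub>j\<close> and makes \<open>H\<close> act by signs on the \<open>i\<close>-th component of each \<open>w \<in> W\<close>.  So \<open>d = 1\<close>,
  \<open>H = {1, -1}\<close>, and the pairs \<open>{i, j}\<close> arising in this way form a partition preserved by \<open>K\<close>.
\<close>

section \<open>The general linear group and images of subspaces\<close>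

lemma group_GL: "group (GL :: ('a::field ^ 'n ^ 'n) monoid)"
proof (rule groupI)
  show "A \<otimes>\<^bsub>GL\<^esub> B \<in> carrier GL" if "A \<in> carrier GL" "B \<in> carrier GL" for A B :: "'a ^ 'n ^ 'n"
    using that by (simp add: GL_def invertible_mult)
next
  fix A :: "'a ^ 'n ^ 'n"
  assume "A \<in> carrier GL"
  then have "invertible A"
    by (simp add: GL_def)
  then show "\<exists>B\<in>carrier GL. B \<otimes>\<^bsub>GL\<^esub> A = \<one>\<^bsub>GL\<^esub>"
    unfolding GL_def
    by (auto simp: invertible_def)
next
  show "\<one>\<^bsub>GL\<^esub> \<in> carrier (GL :: ('a ^ 'n ^ 'n) monoid)"
    unfolding GL_def invertible_def using matrix_mul_lid by auto
qed (simp_all add: GL_def matrix_mul_assoc)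

text \<open>A two-sided inverse inside \<open>G\<close> makes an element invertible and agrees with
  \<open>inv\<close>, by uniqueness of inverses. Later arguments can therefore work with
  \<open>**\<close> and \<open>mat 1\<close> alone.\<close>

lemma subgroup_GL_iff:
  fixes G :: "('a::field ^ 'n ^ 'n) set"
  shows "subgroup G GL \<longleftrightarrow>
    mat 1 \<in> G \<and> (\<forall>A\<in>G. \<forall>B\<in>G. A ** B \<in> G) \<and> (\<forall>A\<in>G. \<exists>B\<in>G. A ** B = mat 1 \<and> B ** A = mat 1)"
    (is "?L \<longleftrightarrow> ?R")
proof
  interpret GL: group "GL :: ('a ^ 'n ^ 'n) monoid"
    by (rule group_GL)
  show ?R if G: ?L
  proof (intro conjI ballI)
    show "mat 1 \<in> G"
      using subgroup.one_closed[OF G] by (simp add: GL_def)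
    show "A ** B \<in> G" if "A \<in> G" "B \<in> G" for A B
      using subgroup.m_closed[OF G that] by (simp add: GL_def)
    show "\<exists>B\<in>G. A ** B = mat 1 \<and> B ** A = mat 1" if "A \<in> G" for A
    proof
      have "A \<in> carrier GL"
        using subgroup.subset[OF G] that by blast
      then show "A ** inv\<^bsub>GL\<^esub> A = mat 1 \<and> inv\<^bsub>GL\<^esub> A ** A = mat 1"
        using GL.r_inv[of A] GL.l_inv[of A] by (simp add: GL_def)
      show "inv\<^bsub>GL\<^esub> A \<in> G"
        using subgroup.m_inv_closed[OF G that] .
    qed
  qed
  show ?L if R: ?R
  proof (rule GL.subgroupI)
    show sub: "G \<subseteq> carrier GL"
      using R by (auto simp: GL_def invertible_def)
    show "inv\<^bsub>GL\<^esub> A \<in> G" if A: "A \<in> G" for A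
    proof -
      obtain B where B: "B \<in> G" "B ** A = mat 1"
        using R A by blast
      have "inv\<^bsub>GL\<^esub> A = B"
        using B A sub by (intro GL.inv_equality) (auto simp: GL_def)
      then show ?thesis
        using B by simp
    qed
    show "G \<noteq> {}"
      using R by blast
    show "A \<otimes>\<^bsub>GL\<^esub> B \<in> G" if "A \<in> G" "B \<in> G" for A B
      using R that by (simp add: GL_def)
  qed
qed

lemma mat_image_mult: "mat_image (A ** B) W = mat_image A (mat_image B W)"
  by (simp add: mat_image_def image_image matrix_vector_mul_assoc)

lemma mat_image_one [simp]: "mat_image (mat 1) W = W"
  by (simp add: mat_image_def)

lemma mat_image_cancel: "A ** B = mat 1 \<Longrightarrow> mat_image A (mat_image B W) = W"
  by (simp flip: mat_image_mult)

lemma mat_image_mem: "w \<in> W \<Longrightarrow> A *v w \<in> mat_image A W"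
  by (simp add: mat_image_def)

section \<open>Block coordinates and the generators of the wreath product\<close>

definition coord :: "'k \<Rightarrow> 'a::field ^ ('k::finite \<times> 'd::finite) \<Rightarrow> 'a ^ 'd" where
  "coord i v = (\<chi> j. v $ (i, j))"

definition emb :: "'k \<Rightarrow> 'a::field ^ 'd::finite \<Rightarrow> 'a ^ ('k::finite \<times> 'd)" where
  "emb i u = (\<chi> p. if fst p = i then u $ snd p else 0)"

definition summand :: "'k::finite \<Rightarrow> ('a::field ^ ('k \<times> 'd::finite)) set" where
  "summand i = range (emb i)"

text \<open>With \<open>A\<close> ranging over \<open>H\<close>, these matrices form the factor
  \<open>B\<^sub>i\<close> of the base group; likewise \<open>summand i\<close> is
  \<open>V\<^sub>i\<close>.\<close>

definition base :: "'k::finite \<Rightarrow> 'a::field ^ 'd ^ 'd \<Rightarrow> 'a ^ ('k \<times> 'd::finite) ^ ('k \<times> 'd)" where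
  "base i A = block_diag (\<lambda>j. if j = i then A else mat 1)"

text \<open>Extensionality by blocks: together with \<open>matrix_eq\<close> it reduces the matrix
  identities below to computations with \<open>coord\<close>.\<close>

lemma vec_eq_coord: "v = w \<longleftrightarrow> (\<forall>i. coord i v = coord i w)"
  by (auto simp: coord_def vec_eq_iff)

lemma coord_simps [simp]:
  "coord i 0 = 0"
  "coord i (v + w) = coord i v + coord i w"
  "coord i (v - w) = coord i v - coord i w"
  "coord i (- v) = - coord i v"
  "coord i (c *s v) = c *s coord i v"
  by (auto simp: coord_def vec_eq_iff)

lemma coord_sum: "coord i (sum f S) = (\<Sum>x\<in>S. coord i (f x))"
  by (induction S rule: infinite_finite_induct) auto

lemma coord_emb [simp]: "coord i (emb j u) = (if i = j then u else 0)"
  by (auto simp: coord_def emb_def vec_eq_iff)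

lemma emb_simps [simp]:
  "emb i 0 = 0"
  "emb i (u + v) = emb i u + emb i v"
  "emb i (c *s u) = c *s emb i u"
  by (auto simp: vec_eq_coord)

lemma emb_sum: "emb i (sum f S) = (\<Sum>x\<in>S. emb i (f x))"
  by (induction S rule: infinite_finite_induct) auto

lemma inj_emb: "inj (emb i)"
  by (rule inj_on_inverseI[where g = "coord i"]) simp

lemma sum_emb_coord: "(\<Sum>i\<in>UNIV. emb i (coord i v)) = v"
  unfolding vec_eq_coord coord_sum by simp

lemma mem_summand: "v \<in> summand i \<longleftrightarrow> (\<forall>j. j \<noteq> i \<longrightarrow> coord j v = 0)"
proof
  assume "\<forall>j. j \<noteq> i \<longrightarrow> coord j v = 0"
  then have "v = emb i (coord i v)"
    by (auto simp: vec_eq_coord)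
  then show "v \<in> summand i"
    unfolding summand_def by (rule range_eqI)
qed (auto simp: summand_def)

lemma emb_mem_summand [simp]: "emb i u \<in> summand i"
  by (simp add: summand_def)

lemma subspace_summand: "vec.subspace (summand i)"
  unfolding vec.subspace_def by (auto simp: mem_summand)

lemma coord_block_diag [simp]: "coord i (block_diag h *v v) = h i *v coord i v"
proof -
  have "(\<Sum>q\<in>UNIV. (if i = fst q then h (fst q) $ j $ snd q else 0) * v $ q) =
      (\<Sum>m\<in>UNIV. h i $ j $ m * v $ (i, m))" for j
  proof -
    have "(\<Sum>q\<in>UNIV. (if i = fst q then h (fst q) $ j $ snd q else 0) * v $ q) =
        (\<Sum>a\<in>UNIV. \<Sum>m\<in>UNIV. (if i = a then h a $ j $ m else 0) * v $ (a, m))"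
      by (simp add: sum.cartesian_product UNIV_Times_UNIV[symmetric] case_prod_beta
          del: UNIV_Times_UNIV)
    also have "\<dots> = (\<Sum>a\<in>UNIV. if i = a then \<Sum>m\<in>UNIV. h a $ j $ m * v $ (a, m) else 0)"
      by (intro sum.cong) auto
    finally show ?thesis
      by simp
  qed
  \<comment> \<open>\<open>block_diag\<close> indexes \<open>h\<close> by the row block, the sum
    above by the column block; the two agree wherever the condition holds.\<close>
  moreover have "(if i = fst q then h i $ j $ snd q else 0) =
      (if i = fst q then h (fst q) $ j $ snd q else 0)" for q j
    by simp
  ultimately show ?thesis
    by (simp add: coord_def block_diag_def matrix_vector_mult_def vec_eq_iff cong: if_cong)
qed

text \<open>Evaluating at the target block \<open>\<sigma> i\<close> avoids an inverse permutation;
  for bijective \<open>\<sigma>\<close> every block has this form, which is how the lemma is applied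
  below.\<close>

lemma coord_block_perm:
  assumes "inj \<sigma>"
  shows "coord (\<sigma> i) (block_perm \<sigma> *v v) = coord i v"
proof -
  have "(\<Sum>q\<in>UNIV. (if i = fst q \<and> j = snd q then 1 else 0) * v $ q) = v $ (i, j)" for j
  proof -
    have "(\<Sum>q\<in>UNIV. (if i = fst q \<and> j = snd q then 1 else 0) * v $ q) =
        (\<Sum>q\<in>UNIV. if q = (i, j) then v $ q else 0)"
      by (rule sum.cong) (auto split: if_split)
    then show ?thesis
      by simp
  qed
  then show ?thesis
    by (simp add: coord_def block_perm_def matrix_vector_mult_def vec_eq_iff inj_eq[OF assms])
qed

lemma coord_base [simp]: "coord j (base i A *v v) = (if j = i then A *v coord i v else coord j v)"
  by (simp add: base_def)

lemma base_emb: "base i A *v emb i u = emb i (A *v u)"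
  by (auto simp: vec_eq_coord)

lemma base_mult: "base i A ** base i B = base i (A ** B)"
  unfolding matrix_eq vec_eq_coord by (simp flip: matrix_vector_mul_assoc)

lemma base_one [simp]: "base i (mat 1) = mat 1"
  unfolding matrix_eq vec_eq_coord by simp

lemma base_commute: "i \<noteq> j \<Longrightarrow> base i A ** base j B = base j B ** base i A"
  unfolding matrix_eq vec_eq_coord by (simp flip: matrix_vector_mul_assoc)

lemma block_perm_id: "block_perm id = mat 1"
  unfolding matrix_eq vec_eq_coord by (simp add: coord_block_perm[OF inj_on_id, simplified])

lemma block_perm_comp:
  assumes "bij \<sigma>" "bij \<tau>"
  shows "block_perm \<sigma> ** block_perm \<tau> = block_perm (\<sigma> \<circ> \<tau>)"
proof -
  have "coord i (block_perm \<sigma> *v (block_perm \<tau> *v v)) = coord i (block_perm (\<sigma> \<circ> \<tau>) *v v)"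
    for i and v :: "'b ^ ('a \<times> 'c)"
  proof -
    obtain m where m: "i = \<sigma> (\<tau> m)"
      using assms by (metis bij_pointE)
    have "inj (\<sigma> \<circ> \<tau>)"
      using assms by (simp add: bij_is_inj inj_compose)
    then show ?thesis
      unfolding m using coord_block_perm[of "\<sigma> \<circ> \<tau>" m v] assms
      by (simp add: coord_block_perm bij_is_inj)
  qed
  then show ?thesis
    unfolding matrix_eq vec_eq_coord by (simp flip: matrix_vector_mul_assoc)
qed

lemma block_diag_mult: "block_diag g ** block_diag h = block_diag (\<lambda>i. g i ** h i)"
  unfolding matrix_eq vec_eq_coord by (simp flip: matrix_vector_mul_assoc)

lemma block_diag_one: "block_diag (\<lambda>i. mat 1) = mat 1"
  unfolding matrix_eq vec_eq_coord by simp

text \<open>The commutation rule of the semidirect product: it moves a permutation past a base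
  element, so that products and inverses return to the shape used in \<open>wreath\<close>.\<close>

lemma block_perm_diag:
  assumes "bij \<sigma>"
  shows "block_perm \<sigma> ** block_diag h = block_diag (h \<circ> inv_into UNIV \<sigma>) ** block_perm \<sigma>"
proof -
  have "coord i (block_perm \<sigma> *v (block_diag h *v v)) =
      coord i (block_diag (h \<circ> inv_into UNIV \<sigma>) *v (block_perm \<sigma> *v v))" for i v
  proof -
    obtain m where m: "i = \<sigma> m"
      using assms by (metis bij_pointE)
    show ?thesis
      using assms unfolding m by (simp add: coord_block_perm bij_is_inj)
  qed
  then show ?thesis
    unfolding matrix_eq vec_eq_coord by (simp flip: matrix_vector_mul_assoc)
qed

lemma block_perm_emb:
  assumes "bij \<sigma>"
  shows "block_perm \<sigma> *v emb i u = emb (\<sigma> i) u"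
  unfolding vec_eq_coord
proof
  fix l
  obtain m where m: "l = \<sigma> m"
    using assms by (metis bij_pointE)
  show "coord l (block_perm \<sigma> *v emb i u) = coord l (emb (\<sigma> i) u)"
    unfolding m using assms by (auto simp: coord_block_perm bij_is_inj inj_eq)
qed

lemma block_diag_emb: "block_diag h *v emb i u = emb i (h i *v u)"
  by (auto simp: vec_eq_coord)

section \<open>The summands and internal direct sums\<close>

lemma inj_summand: "inj (summand :: 'k::finite \<Rightarrow> ('a::field ^ ('k \<times> 'd::finite)) set)"
proof (rule injI, rule ccontr)
  fix i j :: 'k
  assume eq: "summand i = (summand j :: ('a ^ ('k \<times> 'd)) set)" and "i \<noteq> j"
  have "emb i 1 \<in> (summand j :: ('a ^ ('k \<times> 'd)) set)"
    using eq[symmetric] by simp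
  then have "coord i (emb i 1 :: 'a ^ ('k \<times> 'd)) = 0"
    using \<open>i \<noteq> j\<close> unfolding mem_summand by blast
  then show False
    by (simp add: vec_eq_iff)
qed

lemma internal_direct_sum_summands:
  "internal_direct_sum (range summand :: ('a::field ^ ('k::finite \<times> 'd::finite)) set set) UNIV"
  unfolding internal_direct_sum_def
proof (intro conjI allI impI)
  have "\<exists>f. v = (\<Sum>X\<in>range summand. f X) \<and> (\<forall>X\<in>range summand. f X \<in> X)"
    for v :: "'a ^ ('k \<times> 'd)"
    \<comment> \<open>The component in a member \<open>X\<close> is the block of \<open>v\<close>
      whose index is recovered from \<open>X\<close> by inverting \<open>summand\<close>.\<close>
    by (rule exI[of _ "\<lambda>X. emb (inv_into UNIV summand X) (coord (inv_into UNIV summand X) v)"])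
      (simp add: sum.reindex inj_summand sum_emb_coord)
  then show "UNIV = {\<Sum>X\<in>range summand. f X | f. \<forall>X\<in>range summand. f X \<in> (X :: ('a ^ ('k \<times> 'd)) set)}"
    by (simp add: set_eq_iff)
next
  fix f :: "('a ^ ('k \<times> 'd)) set \<Rightarrow> 'a ^ ('k \<times> 'd)"
  assume f: "(\<forall>X\<in>range summand. f X \<in> X) \<and> (\<Sum>X\<in>range summand. f X) = 0"
  have "f (summand i) = 0" for i
  proof -
    have mem: "f (summand j) \<in> summand j" for j
      using f by blast
    have "0 = (\<Sum>j\<in>UNIV. coord i (f (summand j)))"
      using f by (simp add: sum.reindex inj_summand coord_sum[symmetric])
    also have "\<dots> = (\<Sum>j\<in>UNIV. if j = i then coord i (f (summand i)) else 0)"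
      using mem by (intro sum.cong) (auto simp: mem_summand)
    finally have "coord i (f (summand i)) = 0"
      by simp
    then show ?thesis
      using mem[of i] unfolding mem_summand vec_eq_coord by (metis coord_simps(1))
  qed
  then show "\<forall>X\<in>range summand. f X = 0"
    by blast
qed (auto simp: subspace_summand)

text \<open>Directness in the form needed for a relation between four vectors. Only \<open>W\<close>
  has to differ from the other members; \<open>W1\<close>, \<open>W2\<close>, \<open>W3\<close> may
  coincide.\<close>

lemma internal_direct_sum_indep:
  assumes S: "internal_direct_sum S U" and W: "W \<in> S" "W1 \<in> S" "W2 \<in> S" "W3 \<in> S"
    and neq: "W \<noteq> W1" "W \<noteq> W2" "W \<noteq> W3"
    and x: "x \<in> W" "x1 \<in> W1" "x2 \<in> W2" "x3 \<in> W3" and eq: "x = x1 + x2 + x3"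
  shows "x = 0"
proof -
  \<comment> \<open>Adding four separate contributions keeps \<open>f\<close> correct when some of
    \<open>W1\<close>, \<open>W2\<close>, \<open>W3\<close> are equal.\<close>
  define f where "f X = (if X = W then - x else 0) + (if X = W1 then x1 else 0) +
      (if X = W2 then x2 else 0) + (if X = W3 then x3 else 0)" for X
  have fin: "finite S" and sub: "\<And>X. X \<in> S \<Longrightarrow> vec.subspace X"
    using S by (auto simp: internal_direct_sum_def)
  have "f X \<in> X" if "X \<in> S" for X
    unfolding f_def using sub[OF that] x
    by (intro vec.subspace_add) (auto simp: vec.subspace_0 vec.subspace_neg)
  moreover have "(\<Sum>X\<in>S. f X) = 0"
    unfolding f_def using fin W eq by (simp add: sum.distrib)
  moreover have "\<forall>f. (\<forall>W\<in>S. f W \<in> W) \<and> (\<Sum>W\<in>S. f W) = 0 \<longrightarrow> (\<forall>W\<in>S. f W = 0)"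
    using S by (simp add: internal_direct_sum_def)
  ultimately have "f W = 0"
    using W by blast
  then show ?thesis
    using neq by (simp add: f_def)
qed

lemma internal_direct_sum_disjoint:
  assumes S: "internal_direct_sum S U" and "X \<in> S" "Y \<in> S" "x \<in> X" "x \<in> Y" "x \<noteq> 0"
  shows "X = Y"
proof (rule ccontr)
  assume "X \<noteq> Y"
  moreover have "vec.subspace Y"
    using assms by (auto simp: internal_direct_sum_def)
  ultimately show False
    using internal_direct_sum_indep[OF S, of X Y Y Y x x 0 0] assms by (simp add: vec.subspace_0)
qed

text \<open>The sums of one vector per member form a subspace that contains every member, so they
  make up the span. Spans are easier to handle for subfamilies and for invariance.\<close>

lemma internal_direct_sum_iff:
  fixes S :: "('a::field ^ 'n) set set"
  shows "internal_direct_sum S U \<longleftrightarrow> finite S \<and> (\<forall>W\<in>S. vec.subspace W) \<and> U = vec.span (\<Union>S) \<and>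
    (\<forall>f. (\<forall>W\<in>S. f W \<in> W) \<and> (\<Sum>W\<in>S. f W) = 0 \<longrightarrow> (\<forall>W\<in>S. f W = 0))"
proof -
  have "{\<Sum>W\<in>S. f W | f. \<forall>W\<in>S. f W \<in> W} = vec.span (\<Union>S)" (is "?T = _")
    if fin: "finite S" and sub: "\<forall>W\<in>S. vec.subspace W"
  proof
    show "?T \<subseteq> vec.span (\<Union>S)"
      by (auto intro!: vec.span_sum intro: vec.span_base)
    show "vec.span (\<Union>S) \<subseteq> ?T"
    proof (rule vec.span_minimal)
      show "\<Union>S \<subseteq> ?T"
      proof safe
        fix x X
        assume "x \<in> X" "X \<in> S"
        then show "\<exists>f. x = (\<Sum>W\<in>S. f W) \<and> (\<forall>W\<in>S. f W \<in> W)"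
          using fin sub by (intro exI[of _ "\<lambda>W. if W = X then x else 0"]) (auto simp: vec.subspace_0)
      qed
      show "vec.subspace ?T"
        unfolding vec.subspace_def
      proof (intro conjI ballI allI)
        show "0 \<in> ?T"
          using sub by (auto intro!: exI[of _ "\<lambda>W. 0"] simp: vec.subspace_0)
      next
        fix x y
        assume "x \<in> ?T" "y \<in> ?T"
        then obtain f g where "x = (\<Sum>W\<in>S. f W)" "\<forall>W\<in>S. f W \<in> W"
          "y = (\<Sum>W\<in>S. g W)" "\<forall>W\<in>S. g W \<in> W"
          by blast
        then show "x + y \<in> ?T"
          using sub
          by (auto intro!: exI[of _ "\<lambda>W. f W + g W"] simp: sum.distrib vec.subspace_add)
      next
        fix c x
        assume "x \<in> ?T"
        then obtain f where "x = (\<Sum>W\<in>S. f W)" "\<forall>W\<in>S. f W \<in> W"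
          by blast
        then show "c *s x \<in> ?T"
          using sub
          by (auto intro!: exI[of _ "\<lambda>W. c *s f W"] simp: vec.scale_sum_right vec.subspace_scale)
      qed
    qed
  qed
  then show ?thesis
    unfolding internal_direct_sum_def by auto
qed

text \<open>A relation among the members of \<open>T\<close> extends by zero to a relation among the
  members of \<open>S\<close>.\<close>

lemma internal_direct_sum_subset:
  assumes S: "internal_direct_sum S U" and T: "T \<subseteq> S"
  shows "internal_direct_sum T (vec.span (\<Union>T))"
proof -
  have fin: "finite S" and sub: "\<forall>W\<in>S. vec.subspace W"
    and indep: "\<forall>f. (\<forall>W\<in>S. f W \<in> W) \<and> (\<Sum>W\<in>S. f W) = 0 \<longrightarrow> (\<forall>W\<in>S. f W = 0)"
    using S by (simp_all add: internal_direct_sum_def)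
  have "\<forall>W\<in>T. f W = 0" if f: "\<forall>W\<in>T. f W \<in> W" "(\<Sum>W\<in>T. f W) = 0" for f
  proof -
    define g where "g W = (if W \<in> T then f W else 0)" for W
    have "(\<Sum>W\<in>S. g W) = (\<Sum>W\<in>T. f W)"
      unfolding g_def using fin T by (simp add: sum.If_cases Int_absorb1)
    moreover have "\<forall>W\<in>S. g W \<in> W"
      using f sub by (simp add: g_def vec.subspace_0)
    ultimately have "\<forall>W\<in>S. g W = 0"
      using indep f by simp
    then show ?thesis
      using T by (auto simp: g_def split: if_splits)
  qed
  then show ?thesis
    unfolding internal_direct_sum_iff using finite_subset[OF T fin] sub T by (simp add: subset_iff)
qed

lemma subspace_nonzero_member:
  fixes W :: "('a::field ^ 'n) set"
  assumes "vec.subspace W" "W \<noteq> {0}"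
  shows "\<exists>w. w \<in> W \<and> w \<noteq> 0"
proof (rule ccontr)
  assume "\<nexists>w. w \<in> W \<and> w \<noteq> 0"
  moreover have "0 \<in> W"
    using assms(1) by (rule vec.subspace_0)
  ultimately show False
    using assms(2) by auto
qed

text \<open>A nonzero entry of \<open>x\<close> forces \<open>1 + 1 = 0\<close> in the field. This
  is how characteristic 2 is detected in one block and used in another.\<close>

lemma eq_neg_vec:
  fixes x :: "'a::field ^ 'n" and y :: "'a ^ 'm"
  assumes "x = - x" "x \<noteq> 0"
  shows "y = - y"
proof -
  obtain l where l: "x $ l \<noteq> 0"
    using assms by (auto simp: vec_eq_iff)
  have "x $ l = - (x $ l)"
    using assms(1) by (metis vector_uminus_component)
  then have "(1 + 1) * x $ l = 0"
    by (simp add: algebra_simps eq_neg_iff_add_eq_0)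
  then have "(1 + 1 :: 'a) = 0"
    using l by simp
  then have "(1 + 1) * y $ m = 0" for m
    by simp
  then show ?thesis
    by (simp add: vec_eq_iff algebra_simps eq_neg_iff_add_eq_0)
qed

section \<open>The wreath product as an irreducible linear group\<close>

locale wreath_data =
  fixes H :: "('a::field ^ 'd::finite ^ 'd) set" and K :: "('k::finite \<Rightarrow> 'k) set"
  assumes H_nontrivial: "H \<noteq> {mat 1}"
    and H_irreducible: "irreducible_group H"
    and K_subgroup: "subgroup K (BijGroup UNIV)"
    and K_transitive: "transitive_perms K"
begin

lemma one_H [simp]: "mat 1 \<in> H"
  and mult_H: "A \<in> H \<Longrightarrow> B \<in> H \<Longrightarrow> A ** B \<in> H"
  and inverse_H: "A \<in> H \<Longrightarrow> \<exists>B\<in>H. A ** B = mat 1 \<and> B ** A = mat 1"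
  using H_irreducible by (auto simp: irreducible_group_def subgroup_GL_iff)

lemma H_invariant_subspace:
  assumes "vec.subspace W" "\<And>A w. A \<in> H \<Longrightarrow> w \<in> W \<Longrightarrow> A *v w \<in> W"
  shows "W = {0} \<or> W = UNIV"
  using H_irreducible assms by (auto simp: irreducible_group_def mat_image_def image_subset_iff)

text \<open>The common fixed vectors of \<open>H\<close> form an invariant subspace; if it were the
  whole space, \<open>H\<close> would be trivial.\<close>

lemma H_no_fixed_vector:
  assumes "u \<noteq> 0"
  shows "\<exists>A\<in>H. A *v u \<noteq> u"
proof (rule ccontr)
  let ?W = "{u. \<forall>A\<in>H. A *v u = u}"
  assume "\<not> (\<exists>A\<in>H. A *v u \<noteq> u)"
  then have "?W \<noteq> {0}"
    using assms by auto
  moreover have "vec.subspace ?W"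
    by (auto simp: vec.subspace_def matrix_vector_right_distrib vector_scalar_commute)
  ultimately have "?W = UNIV"
    using H_invariant_subspace[of ?W] by auto
  then have "A = mat 1" if "A \<in> H" for A
    using that by (auto simp: matrix_eq)
  then show False
    using H_nontrivial one_H by blast
qed

lemma K_bij: "\<sigma> \<in> K \<Longrightarrow> bij \<sigma>"
  using subgroup.subset[OF K_subgroup] by (auto simp: BijGroup_def Bij_def)

lemma K_id: "id \<in> K"
  using subgroup.one_closed[OF K_subgroup] by (simp add: BijGroup_def id_def restrict_def)

lemma K_comp: "\<sigma> \<in> K \<Longrightarrow> \<tau> \<in> K \<Longrightarrow> \<sigma> \<circ> \<tau> \<in> K"
  using subgroup.m_closed[OF K_subgroup, of \<sigma> \<tau>] subgroup.subset[OF K_subgroup]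
  by (auto simp: BijGroup_def compose_def comp_def restrict_def subset_iff)

lemma K_inv:
  assumes "\<sigma> \<in> K"
  shows "inv_into UNIV \<sigma> \<in> K"
proof -
  have "\<sigma> \<in> Bij UNIV"
    using assms subgroup.subset[OF K_subgroup] by (auto simp: BijGroup_def)
  then show ?thesis
    using subgroup.m_inv_closed[OF K_subgroup assms] by (simp add: inv_BijGroup restrict_def)
qed

lemma wreathI: "(\<And>i. h i \<in> H) \<Longrightarrow> \<sigma> \<in> K \<Longrightarrow> block_diag h ** block_perm \<sigma> \<in> wreath H K"
  unfolding wreath_def by blast

lemma base_wreath:
  assumes "A \<in> H"
  shows "base i A \<in> wreath H K"
  using wreathI[of "\<lambda>j. if j = i then A else mat 1" id] assms K_id
  by (simp add: base_def block_perm_id)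

lemma block_perm_wreath: "\<sigma> \<in> K \<Longrightarrow> block_perm \<sigma> \<in> wreath H K"
  using wreathI[of "\<lambda>_. mat 1" \<sigma>] by (simp add: block_diag_one)

lemma subgroup_wreath: "subgroup (wreath H K) GL"
  unfolding subgroup_GL_iff
proof (intro conjI ballI)
  show "mat 1 \<in> wreath H K"
    using base_wreath[OF one_H] by simp
next
  fix X Y
  assume "X \<in> wreath H K" "Y \<in> wreath H K"
  then obtain h \<sigma> g \<tau> where X: "X = block_diag h ** block_perm \<sigma>" "\<And>i. h i \<in> H" "\<sigma> \<in> K"
    and Y: "Y = block_diag g ** block_perm \<tau>" "\<And>i. g i \<in> H" "\<tau> \<in> K"
    by (auto simp: wreath_def)
  have "X ** Y = block_diag h ** (block_perm \<sigma> ** block_diag g) ** block_perm \<tau>"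
    by (simp add: X Y matrix_mul_assoc)
  also have "\<dots> = (block_diag h ** block_diag (g \<circ> inv_into UNIV \<sigma>)) ** (block_perm \<sigma> ** block_perm \<tau>)"
    unfolding block_perm_diag[OF K_bij[OF X(3)]] by (simp add: matrix_mul_assoc)
  also have "\<dots> = block_diag (\<lambda>i. h i ** g (inv_into UNIV \<sigma> i)) ** block_perm (\<sigma> \<circ> \<tau>)"
    by (simp add: block_diag_mult block_perm_comp K_bij X Y)
  finally show "X ** Y \<in> wreath H K"
    using X Y by (simp add: wreathI mult_H K_comp)
next
  fix X
  assume "X \<in> wreath H K"
  then obtain h \<sigma> where X: "X = block_diag h ** block_perm \<sigma>" "\<And>i. h i \<in> H" "\<sigma> \<in> K"
    by (auto simp: wreath_def)
  obtain g where g: "\<And>i. g i \<in> H" "\<And>i. h i ** g i = mat 1" "\<And>i. g i ** h i = mat 1"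
    using bchoice[of UNIV "\<lambda>i B. B \<in> H \<and> h i ** B = mat 1 \<and> B ** h i = mat 1"] inverse_H X(2)
    by blast
  define \<tau> where "\<tau> = inv_into UNIV \<sigma>"
  have \<tau>: "\<tau> \<in> K" "\<sigma> \<circ> \<tau> = id" "\<tau> \<circ> \<sigma> = id"
    using X(3) K_inv K_bij[OF X(3)] surj_iff[of \<sigma>] inj_iff[of \<sigma>]
    by (auto simp: \<tau>_def bij_is_surj bij_is_inj)
  \<comment> \<open>The inverse has the two factors in reverse order; this rewriting brings it back
    to the shape required by \<open>wreath\<close>.\<close>
  have Y: "block_perm \<tau> ** block_diag g = block_diag (g \<circ> inv_into UNIV \<tau>) ** block_perm \<tau>"
    using \<tau> K_bij by (intro block_perm_diag)
  have 1: "X ** (block_perm \<tau> ** block_diag g) = mat 1"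
  proof -
    have "X ** (block_perm \<tau> ** block_diag g) =
        block_diag h ** (block_perm \<sigma> ** block_perm \<tau>) ** block_diag g"
      by (simp add: X matrix_mul_assoc)
    then show ?thesis
      by (simp add: block_perm_comp K_bij X \<tau> block_perm_id block_diag_mult g block_diag_one)
  qed
  moreover have "block_perm \<tau> ** block_diag g ** X = mat 1"
    using 1 matrix_left_right_inverse by blast
  moreover have "block_perm \<tau> ** block_diag g \<in> wreath H K"
    unfolding Y using g \<tau> by (intro wreathI) auto
  ultimately show "\<exists>Y\<in>wreath H K. X ** Y = mat 1 \<and> Y ** X = mat 1"
    by blast
qed

lemma subspace_emb_vimage:
  assumes "vec.subspace W"
  shows "vec.subspace (emb i -` W)"
  using assms by (auto simp: vec.subspace_def)

text \<open>The preimage of \<open>W\<close> under \<open>emb i\<close> is an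
  \<open>H\<close>-invariant subspace, nonzero because of \<open>v\<close>, hence everything by
  irreducibility.\<close>

lemma summand_subset:
  assumes W: "vec.subspace W" "\<And>A w. A \<in> H \<Longrightarrow> w \<in> W \<Longrightarrow> base i A *v w \<in> W"
    and v: "v \<in> W" "v \<in> summand i" "v \<noteq> 0"
  shows "summand i \<subseteq> W"
proof -
  obtain u where u: "v = emb i u"
    using v by (auto simp: summand_def)
  have "u \<in> emb i -` W" "u \<noteq> 0"
    using u v by auto
  moreover have "A *v x \<in> emb i -` W" if "A \<in> H" "x \<in> emb i -` W" for A x
    using W(2)[of A "emb i x"] that by (simp add: base_emb)
  ultimately have "emb i -` W = UNIV"
    using H_invariant_subspace[OF subspace_emb_vimage[OF W(1)]] by blast
  then show ?thesis
    by (auto simp: summand_def)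
qed

text \<open>Together with \<open>exists_base_moving\<close> this extracts a nonzero vector of the
  \<open>i\<close>-th summand from any vector with nonzero \<open>i\<close>-th block, without
  leaving a subspace invariant under the base group.\<close>

lemma base_diff_mem_summand: "base i A *v v - v \<in> summand i"
  by (simp add: mem_summand)

lemma exists_base_moving:
  assumes "coord i v \<noteq> 0"
  shows "\<exists>A\<in>H. base i A *v v \<noteq> v"
  using H_no_fixed_vector[OF assms] by (metis coord_base)

text \<open>A nonzero invariant subspace contains a nonzero vector of some summand, hence that
  summand, and transitivity of \<open>K\<close> carries it to all the others.\<close>

lemma irreducible_wreath: "irreducible_group (wreath H K)"
  unfolding irreducible_group_def
proof (intro conjI allI impI subgroup_wreath)
  fix W :: "('a ^ ('k \<times> 'd)) set"
  assume W: "vec.subspace W \<and> (\<forall>A\<in>wreath H K. mat_image A W \<subseteq> W)"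
  then have sub: "vec.subspace W" and inv: "\<And>A w. A \<in> wreath H K \<Longrightarrow> w \<in> W \<Longrightarrow> A *v w \<in> W"
    by (auto simp: mat_image_def)
  have "W = UNIV" if nz: "W \<noteq> {0}"
  proof -
    obtain w where w: "w \<in> W" "w \<noteq> 0"
      using subspace_nonzero_member[OF sub nz] by blast
    then obtain i where i: "coord i w \<noteq> 0"
      by (auto simp: vec_eq_coord)
    then obtain A where A: "A \<in> H" "base i A *v w \<noteq> w"
      using exists_base_moving by blast
    have "base i A *v w - w \<in> W"
      using A w by (intro vec.subspace_diff sub inv base_wreath)
    then have Wi: "summand i \<subseteq> W"
      using A inv base_wreath base_diff_mem_summand
      by (intro summand_subset[OF sub, of _ "base i A *v w - w"]) auto
    have "emb j u \<in> W" for j u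
    proof -
      obtain \<sigma> where \<sigma>: "\<sigma> \<in> K" "\<sigma> i = j"
        using K_transitive by (auto simp: transitive_perms_def)
      have "block_perm \<sigma> *v emb i u = emb j u"
        by (simp add: block_perm_emb K_bij \<sigma>)
      then show ?thesis
        using inv[OF block_perm_wreath[OF \<sigma>(1)], of "emb i u"] subsetD[OF Wi emb_mem_summand] by simp
    qed
    then have "v \<in> W" for v
      using sum_emb_coord[of v] vec.subspace_sum[OF sub] by metis
    then show ?thesis
      by blast
  qed
  then show "W = {0} \<or> W = UNIV"
    by blast
qed

lemma summands_system:
  assumes "CARD('k) > 1"
  shows "system_of_imprimitivity (wreath H K) (range summand)"
  unfolding system_of_imprimitivity_def
proof (intro conjI ballI internal_direct_sum_summands)
  show "1 < card (range summand :: ('a ^ ('k \<times> 'd)) set set)"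
    using assms by (simp add: card_image inj_summand)
next
  fix X :: "('a ^ ('k \<times> 'd)) set"
  assume "X \<in> range summand"
  then obtain i where X: "X = summand i"
    by blast
  show "vec.subspace X"
    unfolding X by (rule subspace_summand)
  have "emb i 1 \<in> X" "coord i (emb i 1 :: 'a ^ ('k \<times> 'd)) \<noteq> 0"
    unfolding X by (simp_all add: vec_eq_iff)
  then show "X \<noteq> {0}"
    by (metis coord_simps(1) singletonD)
next
  \<comment> \<open>It suffices that summands go to summands: the same fact for the inverse matrix
    then yields bijectivity.\<close>
  have image: "mat_image X Y \<in> range summand"
    if "X \<in> wreath H K" "Y \<in> range summand" for X and Y :: "('a ^ ('k \<times> 'd)) set"
  proof -
    obtain h \<sigma> i where X: "X = block_diag h ** block_perm \<sigma>" "\<And>i. h i \<in> H" "\<sigma> \<in> K"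
      and Y: "Y = summand i"
      using \<open>X \<in> wreath H K\<close> \<open>Y \<in> range summand\<close> by (auto simp: wreath_def)
    obtain C where C: "h (\<sigma> i) ** C = mat 1"
      using inverse_H X(2) by blast
    have "X *v emb i u = emb (\<sigma> i) (h (\<sigma> i) *v u)" for u
      by (simp add: X block_perm_emb K_bij block_diag_emb flip: matrix_vector_mul_assoc)
    then have "mat_image X Y = emb (\<sigma> i) ` range (\<lambda>u. h (\<sigma> i) *v u)"
      by (simp add: mat_image_def Y summand_def image_image)
    also have "range (\<lambda>u. h (\<sigma> i) *v u) = UNIV"
      using C by (intro surjI[of _ "\<lambda>u. C *v u"]) (simp add: matrix_vector_mul_assoc)
    finally show ?thesis
      by (simp add: summand_def)
  qed
  fix X
  assume X: "X \<in> wreath H K"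
  then obtain Y where Y: "Y \<in> wreath H K" "X ** Y = mat 1" "Y ** X = mat 1"
    using subgroup_wreath unfolding subgroup_GL_iff by blast
  then show "bij_betw (mat_image X) (range summand) (range summand)"
    using image X
    by (intro bij_betw_byWitness[of _ "mat_image Y"]) (simp_all add: mat_image_cancel image_subset_iff)
qed

end

section \<open>Pairings of the blocks and the refinement order\<close>

text \<open>The hypotheses say that \<open>R\<close> is a perfect matching. Its edges are the blocks
  of size 2; counting them gives the parity, and equivariance shows that \<open>K\<close> permutes
  them.\<close>

lemma even_card_preserves_pairing:
  fixes K :: "('k::finite \<Rightarrow> 'k) set"
  assumes ex: "\<And>i. \<exists>j. R i j" and unique: "\<And>i j j'. R i j \<Longrightarrow> R i j' \<Longrightarrow> j = j'"
    and irrefl: "\<And>i. \<not> R i i" and sym: "\<And>i j. R i j \<Longrightarrow> R j i"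
    and equivariant: "\<And>\<sigma> i j. \<sigma> \<in> K \<Longrightarrow> R i j \<Longrightarrow> R (\<sigma> i) (\<sigma> j)"
  shows "even CARD('k) \<and> preserves_pairing K"
proof -
  define P where "P = {{i, j} | i j. R i j}"
  have mem: "{i, j} \<in> P" if "R i j" for i j
    unfolding P_def using that by (intro CollectI exI[of _ i] exI[of _ j]) simp
  have Union: "\<Union>P = UNIV"
  proof -
    have "l \<in> \<Union>P" for l
      using ex[of l] mem by blast
    then show ?thesis
      by blast
  qed
  have disjoint: "X = Y" if "X \<in> P" "Y \<in> P" "l \<in> X" "l \<in> Y" for X Y l
  proof -
    have "\<exists>j. X = {l, j} \<and> R l j" if "X \<in> P" "l \<in> X" for X
      using that sym by (auto simp: P_def insert_commute)
    then show ?thesis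
      using that unique by metis
  qed
  have card2: "card X = 2" if X: "X \<in> P" for X
  proof -
    obtain i j where ij: "X = {i, j}" "R i j"
      using X by (auto simp: P_def)
    then have "i \<noteq> j"
      using irrefl by metis
    then show ?thesis
      using ij by simp
  qed
  have "2 * card P = card (\<Union>P)"
    using card2 disjoint by (intro card_partition) auto
  then have card: "CARD('k) = 2 * card P"
    using Union by simp
  have "partition_on UNIV P"
    using Union disjoint card2[of "{}"] by (intro partition_onI) (auto simp: disjnt_iff)
  moreover have "\<sigma> ` X \<in> P" if \<sigma>: "\<sigma> \<in> K" and X: "X \<in> P" for \<sigma> X
  proof -
    obtain i j where "X = {i, j}" "R i j"
      using X by (auto simp: P_def)
    then show ?thesis
      using mem[OF equivariant[OF \<sigma>]] by simp
  qed
  ultimately show ?thesis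
    using card card2 unfolding preserves_pairing_def by auto
qed

text \<open>A member \<open>Z\<close> of \<open>\<Delta>\<close> contains a member \<open>X\<close>
  of \<open>\<Gamma>\<close>, which contains a member \<open>Y\<close> of \<open>\<Delta>\<close>.
  Then \<open>Y\<close> and \<open>Z\<close> share a nonzero vector, so \<open>Y = Z\<close>, and
  \<open>X\<close> is squeezed between them.\<close>

lemma refinement_antisym:
  assumes "refinement G \<Delta> \<Gamma>" "refinement G \<Gamma> \<Delta>"
  shows "\<Delta> = \<Gamma>"
proof -
  have "Z \<in> \<Gamma>" if ref: "refinement G \<Delta> \<Gamma>" "refinement G \<Gamma> \<Delta>" and Z: "Z \<in> \<Delta>" for \<Gamma> \<Delta> Z
  proof -
    have part: "\<exists>X\<in>\<Delta>. X \<subseteq> W" if "refinement G \<Delta> \<Gamma>" "W \<in> \<Gamma>" "W \<noteq> {0}" for \<Gamma> \<Delta> W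
    proof -
      obtain S where S: "S \<subseteq> \<Delta>" "internal_direct_sum S W"
        using \<open>refinement G \<Delta> \<Gamma>\<close> \<open>W \<in> \<Gamma>\<close> by (auto simp: refinement_def)
      have W: "W = vec.span (\<Union>S)"
        using S by (simp add: internal_direct_sum_iff)
      then have "S \<noteq> {}"
        using \<open>W \<noteq> {0}\<close> by auto
      then obtain X where "X \<in> S"
        by blast
      moreover have "X \<subseteq> W"
        unfolding W using \<open>X \<in> S\<close> by (blast intro: vec.span_base)
      ultimately show ?thesis
        using S by blast
    qed
    have sys: "system_of_imprimitivity G \<Gamma>" "system_of_imprimitivity G \<Delta>"
      using ref by (auto simp: refinement_def)
    then have nz: "W \<noteq> {0}" and sub: "vec.subspace W" if "W \<in> \<Gamma> \<union> \<Delta>" for W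
      using that by (auto simp: system_of_imprimitivity_def)
    obtain X where X: "X \<in> \<Gamma>" "X \<subseteq> Z"
      using part[OF ref(2) Z] nz Z by blast
    obtain Y where Y: "Y \<in> \<Delta>" "Y \<subseteq> X"
      using part[OF ref(1) X(1)] nz X by blast
    obtain y where "y \<in> Y" "y \<noteq> 0"
      using subspace_nonzero_member[OF sub nz] Y by blast
    moreover have "internal_direct_sum \<Delta> UNIV"
      using sys by (simp add: system_of_imprimitivity_def)
    ultimately have "Y = Z"
      using internal_direct_sum_disjoint Y X Z by blast
    then show ?thesis
      using X Y by auto
  qed
  then show ?thesis
    using assms by blast
qed

section \<open>The base group acting on an arbitrary system\<close>

locale wreath_system = wreath_data H K
  for H :: "('a::field ^ 'd::finite ^ 'd) set" and K :: "('k::finite \<Rightarrow> 'k) set" +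
  fixes \<Gamma> :: "('a ^ ('k \<times> 'd)) set set"
  assumes H_primitive: "primitive_group H"
    and \<Gamma>_system: "system_of_imprimitivity (wreath H K) \<Gamma>"
begin

lemma \<Gamma>_direct: "internal_direct_sum \<Gamma> UNIV"
  and \<Gamma>_finite: "finite \<Gamma>"
  and \<Gamma>_subspace: "W \<in> \<Gamma> \<Longrightarrow> vec.subspace W"
  and \<Gamma>_nonzero: "W \<in> \<Gamma> \<Longrightarrow> W \<noteq> {0}"
  using \<Gamma>_system by (auto simp: system_of_imprimitivity_def internal_direct_sum_def)

lemma \<Gamma>_span: "vec.span (\<Union>\<Gamma>) = UNIV"
  using \<Gamma>_direct by (simp add: internal_direct_sum_iff)

lemma \<Gamma>_mat_image: "A \<in> wreath H K \<Longrightarrow> W \<in> \<Gamma> \<Longrightarrow> mat_image A W \<in> \<Gamma>"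
  using \<Gamma>_system by (auto simp: system_of_imprimitivity_def bij_betw_def)

lemmas \<Gamma>_base = \<Gamma>_mat_image[OF base_wreath]

lemma \<Gamma>_disjoint: "X \<in> \<Gamma> \<Longrightarrow> Y \<in> \<Gamma> \<Longrightarrow> x \<in> X \<Longrightarrow> x \<in> Y \<Longrightarrow> x \<noteq> 0 \<Longrightarrow> X = Y"
  by (rule internal_direct_sum_disjoint[OF \<Gamma>_direct])

lemma \<Gamma>_nonzero_member: "W \<in> \<Gamma> \<Longrightarrow> \<exists>w. w \<in> W \<and> w \<noteq> 0"
  by (rule subspace_nonzero_member[OF \<Gamma>_subspace \<Gamma>_nonzero])

lemma base_eq_zero:
  assumes "A \<in> H" "base i A *v w = 0"
  shows "w = 0"
proof -
  obtain B where "B ** A = mat 1"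
    using inverse_H assms by blast
  then have "base i B *v (base i A *v w) = w"
    by (simp add: matrix_vector_mul_assoc base_mult)
  then show ?thesis
    using assms by simp
qed

text \<open>Here primitivity of \<open>H\<close> enters: if \<open>W\<close> were moved, the members
  inside the \<open>i\<close>-th summand would number at least two and give a system of
  imprimitivity for \<open>H\<close>.\<close>

lemma base_fixes_subset_summand:
  assumes W: "W \<in> \<Gamma>" "W \<subseteq> summand i" and A: "A \<in> H"
  shows "mat_image (base i A) W = W"
proof (rule ccontr)
  assume moved: "mat_image (base i A) W \<noteq> W"
  \<comment> \<open>All members of \<open>\<Gamma>\<close> inside the \<open>i\<close>-th summand,
    pulled back along \<open>emb i\<close>, and not just the orbit of \<open>W\<close>; finiteness
    and independence are inherited from \<open>\<Gamma>\<close>.\<close>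
  define \<Delta> where "\<Delta> = {Y. emb i ` Y \<in> \<Gamma>}"
  have emb_coord: "emb i ` coord i ` X = X" if "X \<subseteq> summand i" for X
  proof -
    have "emb i (coord i x) = x" if "x \<in> X" for x
      using that \<open>X \<subseteq> summand i\<close> by (auto simp: vec_eq_coord mem_summand)
    then show ?thesis
      by (auto simp: image_image)
  qed
  have base_emb_image: "emb i ` mat_image B Y = mat_image (base i B) (emb i ` Y)" for B Y
    by (simp add: mat_image_def image_image base_emb)
  have mem: "coord i ` X \<in> \<Delta>" if "X \<in> \<Gamma>" "X \<subseteq> summand i" for X
    using that by (simp add: \<Delta>_def emb_coord)
  have invariant: "mat_image B Y \<in> \<Delta>" if "B \<in> H" "Y \<in> \<Delta>" for B Y
    using that by (simp add: \<Delta>_def base_emb_image \<Gamma>_base)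
  have sub: "vec.subspace Y" and nz: "Y \<noteq> {0}" if "Y \<in> \<Delta>" for Y
  proof -
    have "emb i -` (emb i ` Y) = Y"
      by (rule inj_vimage_image_eq[OF inj_emb])
    then show "vec.subspace Y"
      using subspace_emb_vimage[of "emb i ` Y" i] \<Gamma>_subspace that by (simp add: \<Delta>_def)
    show "Y \<noteq> {0}"
      using that \<Gamma>_nonzero[of "emb i ` Y"] by (auto simp: \<Delta>_def)
  qed
  have "finite ((`) (emb i) -` \<Gamma>)"
    by (intro finite_vimageI \<Gamma>_finite inj_onI) (simp add: inj_image_eq_iff[OF inj_emb])
  then have fin: "finite \<Delta>"
    by (simp add: \<Delta>_def vimage_def)
  let ?AW = "mat_image (base i A) W"
  have AW: "?AW \<in> \<Gamma>" "?AW \<subseteq> summand i"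
    using W A \<Gamma>_base by (auto simp: mat_image_def mem_summand subset_iff)
  have "coord i ` W \<noteq> coord i ` ?AW"
    using moved emb_coord[OF W(2)] emb_coord[OF AW(2)] by metis
  then have "card {coord i ` W, coord i ` ?AW} = 2"
    by simp
  then have card: "card \<Delta> > 1"
    using card_mono[OF fin, of "{coord i ` W, coord i ` ?AW}"] mem W AW by simp
  \<comment> \<open>The span is \<open>H\<close>-invariant and nonzero, so irreducibility makes it
    the whole space.\<close>
  have "B *v x \<in> vec.span (\<Union>\<Delta>)" if B: "B \<in> H" and x: "x \<in> vec.span (\<Union>\<Delta>)" for B x
    using x
  proof (induction rule: vec.span_induct_alt)
    case base
    show ?case
      by (simp add: vec.span_zero)
  next
    case (step c x y)
    have "B *v x \<in> \<Union>\<Delta>"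
      using step(1) invariant[OF B] mat_image_mem[of x _ B] by blast
    then show ?case
      using step(2)
      by (simp add: matrix_vector_right_distrib vector_scalar_commute vec.span_add vec.span_scale
          vec.span_base)
  qed
  moreover have "vec.span (\<Union>\<Delta>) \<noteq> {0}"
  proof -
    obtain w where "w \<in> coord i ` W" "w \<noteq> 0"
      using subspace_nonzero_member[OF sub nz] mem[OF W] by blast
    then have "w \<in> vec.span (\<Union>\<Delta>)"
      by (intro vec.span_base UnionI[OF mem[OF W]])
    then show ?thesis
      using \<open>w \<noteq> 0\<close> by auto
  qed
  ultimately have span: "vec.span (\<Union>\<Delta>) = UNIV"
    using H_invariant_subspace[of "vec.span (\<Union>\<Delta>)"] by auto
  have "internal_direct_sum \<Delta> UNIV"
    unfolding internal_direct_sum_iff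
  proof (intro conjI allI impI ballI fin sub span[symmetric])
    fix f Y
    assume f: "(\<forall>Y\<in>\<Delta>. f Y \<in> Y) \<and> (\<Sum>Y\<in>\<Delta>. f Y) = 0" and "Y \<in> \<Delta>"
    let ?T = "(`) (emb i) ` \<Delta>"
    define g where "g X = emb i (f (emb i -` X))" for X
    have g: "g (emb i ` Y) = emb i (f Y)" for Y
      by (simp add: g_def inj_vimage_image_eq[OF inj_emb])
    have "?T \<subseteq> \<Gamma>"
      by (auto simp: \<Delta>_def)
    then have "internal_direct_sum ?T (vec.span (\<Union>?T))"
      by (rule internal_direct_sum_subset[OF \<Gamma>_direct])
    then have "(\<forall>X\<in>?T. g X \<in> X) \<and> (\<Sum>X\<in>?T. g X) = 0 \<longrightarrow> (\<forall>X\<in>?T. g X = 0)"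
      unfolding internal_direct_sum_def by (elim conjE allE[of _ g])
    moreover have "(\<Sum>X\<in>?T. g X) = (\<Sum>Y\<in>\<Delta>. emb i (f Y))"
      by (subst sum.reindex) (auto simp: inj_on_def inj_image_eq_iff[OF inj_emb] g)
    then have "(\<Sum>X\<in>?T. g X) = 0"
      using f by (simp flip: emb_sum)
    moreover have "\<forall>X\<in>?T. g X \<in> X"
      using f by (auto simp: g)
    ultimately have "emb i (f Y) = 0"
      using \<open>Y \<in> \<Delta>\<close> by (simp add: g)
    then have "coord i (emb i (f Y)) = 0"
      by simp
    then show "f Y = 0"
      by simp
  qed
  moreover have "bij_betw (mat_image B) \<Delta> \<Delta>" if B: "B \<in> H" for B
  proof -
    obtain C where C: "C \<in> H" "B ** C = mat 1" "C ** B = mat 1"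
      using inverse_H B by blast
    then show ?thesis
      using B invariant by (intro bij_betw_byWitness[of _ "mat_image C"]) (auto simp: mat_image_cancel)
  qed
  ultimately have "system_of_imprimitivity H \<Delta>"
    unfolding system_of_imprimitivity_def using card sub nz by blast
  then show False
    using H_primitive by (auto simp: primitive_group_def)
qed

text \<open>
  The commutator argument: \<open>(h - 1) (b - 1) = 0\<close> for \<open>h\<close> and \<open>b\<close> in different factors of the base
  group, so the vectors \<open>w\<close>, \<open>h w\<close>, \<open>b w\<close>, \<open>b h w\<close> are dependent and the members of \<open>\<Gamma>\<close>
  containing them cannot be distinct.
\<close>

lemma base_commutator_cases:
  assumes W: "W \<in> \<Gamma>" and ij: "i \<noteq> j" and A: "A \<in> H" and B: "B \<in> H"
    and moved: "mat_image (base i A) W \<noteq> W"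
  shows "(\<forall>w\<in>W. base j B *v w = w) \<or>
    mat_image (base j B) W = mat_image (base i A) W \<and>
    (\<forall>w\<in>W. base i A *v w = - (base j B *v w) \<and> base j B *v (base i A *v w) = - w)"
proof -
  define h b where "h = base i A" and "b = base j B"
  have hb: "h *v (b *v w) = b *v (h *v w)" for w
    using base_commute[OF ij, of A B] by (simp add: h_def b_def matrix_vector_mul_assoc)
  \<comment> \<open>This is \<open>(h - 1) (b - 1) w = 0\<close> rearranged; it holds because each
    block is changed by at most one of \<open>h\<close> and \<open>b\<close>.\<close>
  have rel: "w + b *v (h *v w) = h *v w + b *v w" for w
    unfolding vec_eq_coord using ij by (auto simp: h_def b_def)
  let ?hW = "mat_image h W" and ?bW = "mat_image b W" and ?bhW = "mat_image b (mat_image h W)"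
  have mem: "?hW \<in> \<Gamma>" "?bW \<in> \<Gamma>" "?bhW \<in> \<Gamma>"
    using W A B by (auto simp: h_def b_def \<Gamma>_base)
  have moved: "?hW \<noteq> W"
    using moved by (simp add: h_def)
  show ?thesis
  proof (cases "?bW = W")
    case True
    \<comment> \<open>By \<open>rel\<close>, \<open>h\<close> fixes \<open>w - b *v w\<close>, which
      therefore lies in the distinct members \<open>W\<close> and \<open>?hW\<close>.\<close>
    have "b *v w = w" if w: "w \<in> W" for w
    proof -
      have bw: "b *v w \<in> W"
        using mat_image_mem[OF w, of b] True by simp
      have "w - b *v w \<in> W"
        using w bw by (intro vec.subspace_diff \<Gamma>_subspace W)
      moreover have "w - b *v w = h *v (w - b *v w)"
        using rel[of w] by (simp add: matrix_vector_mult_diff_distrib hb algebra_simps)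
      then have "w - b *v w \<in> ?hW"
        using calculation mat_image_mem by metis
      ultimately have "w - b *v w = 0"
        using \<Gamma>_disjoint[OF W mem(1)] moved by metis
      then show ?thesis
        by simp
    qed
    then show ?thesis
      by (simp add: b_def)
  next
    case False
    obtain w where w: "w \<in> W" "w \<noteq> 0"
      using \<Gamma>_nonzero_member[OF W] by blast
    have hw: "h *v w \<in> ?hW" "b *v w \<in> ?bW" "b *v (h *v w) \<in> ?bhW"
      using w by (auto intro!: mat_image_mem)
    have "- (b *v (h *v w)) \<in> ?bhW"
      using hw mem by (intro vec.subspace_neg \<Gamma>_subspace)
    \<comment> \<open>Solving \<open>rel\<close> for \<open>w\<close> expresses it through
      \<open>?hW\<close>, \<open>?bW\<close> and \<open>?bhW\<close>. The first two differ from
      \<open>W\<close>, so the third must be \<open>W\<close>.\<close>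
    moreover have "w = h *v w + b *v w + - (b *v (h *v w))"
      using rel[of w] by (simp add: algebra_simps)
    ultimately have bhW: "?bhW = W"
      using internal_direct_sum_indep[OF \<Gamma>_direct W mem _ _ _ w(1) hw(1,2)] w(2) moved False
      by metis
    have "- (b *v w) \<in> ?bW"
      using hw mem by (intro vec.subspace_neg \<Gamma>_subspace)
    \<comment> \<open>The same relation solved for \<open>h *v w\<close>: now only
      \<open>?bW\<close> can coincide with \<open>?hW\<close>.\<close>
    moreover have "h *v w = w + - (b *v w) + b *v (h *v w)"
      using rel[of w] by (simp add: algebra_simps)
    moreover have "h *v w \<noteq> 0"
      using base_eq_zero[OF A] w by (auto simp: h_def)
    ultimately have bW: "?hW = ?bW"
      using internal_direct_sum_indep[OF \<Gamma>_direct mem(1) W mem(2,3) _ _ _ hw(1) w(1) _ hw(3)] moved bhW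
      by metis
    \<comment> \<open>The two sides of \<open>rel\<close> now lie in the distinct members
      \<open>W\<close> and \<open>?hW\<close>, so both vanish.\<close>
    have "h *v v = - (b *v v) \<and> b *v (h *v v) = - v" if v: "v \<in> W" for v
    proof -
      have "v + b *v (h *v v) \<in> W"
        using v mat_image_mem[OF mat_image_mem[OF v], of b h] bhW
        by (intro vec.subspace_add \<Gamma>_subspace W) auto
      moreover have "h *v v + b *v v \<in> ?hW"
        using mat_image_mem[OF v, of h] mat_image_mem[OF v, of b] bW
        by (intro vec.subspace_add \<Gamma>_subspace mem) auto
      ultimately have "v + b *v (h *v v) = 0"
        using \<Gamma>_disjoint[OF W mem(1)] moved rel[of v] by metis
      then show ?thesis
        using rel[of v] by (simp add: eq_neg_iff_add_eq_0 add.commute)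
    qed
    then show ?thesis
      using bW[symmetric] unfolding h_def b_def by blast
  qed
qed

text \<open>As \<open>W\<close> cannot lie in the \<open>i\<close>-th summand, some
  \<open>base j B\<close> with \<open>j \<noteq> i\<close> moves a vector of \<open>W\<close>. The
  dichotomy then gives \<open>base i A *v w = - (base j B *v w)\<close> on \<open>W\<close>, and
  everything follows by comparing blocks.\<close>

lemma moved_member:
  assumes W: "W \<in> \<Gamma>" and A: "A \<in> H" and moved: "mat_image (base i A) W \<noteq> W"
  obtains j where "j \<noteq> i" "\<And>w l. w \<in> W \<Longrightarrow> l \<noteq> i \<Longrightarrow> l \<noteq> j \<Longrightarrow> coord l w = 0"
    "\<And>w. w \<in> W \<Longrightarrow> w \<noteq> 0 \<Longrightarrow> coord i w \<noteq> 0 \<and> coord j w \<noteq> 0"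
    "\<And>w. w \<in> W \<Longrightarrow> A *v coord i w = - coord i w"
    "\<And>B w. B \<in> H \<Longrightarrow> w \<in> W \<Longrightarrow> B *v coord i w = coord i w \<or> B *v coord i w = - coord i w"
proof -
  have "\<exists>j B. j \<noteq> i \<and> B \<in> H \<and> \<not> (\<forall>w\<in>W. base j B *v w = w)"
  proof (rule ccontr)
    assume "\<not> ?thesis"
    then have fixed: "base j B *v w = w" if "j \<noteq> i" "B \<in> H" "w \<in> W" for j B w
      using that by blast
    have "W \<subseteq> summand i"
      unfolding mem_summand subset_iff using exists_base_moving fixed by metis
    then show False
      using base_fixes_subset_summand[OF W _ A] moved by blast
  qed
  then obtain j B where j: "j \<noteq> i" and B: "B \<in> H" and nfix: "\<not> (\<forall>w\<in>W. base j B *v w = w)"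
    by blast
  from base_commutator_cases[OF W j[symmetric] A B moved] nfix
  have bW: "mat_image (base j B) W = mat_image (base i A) W"
    and hw: "\<And>w. w \<in> W \<Longrightarrow> base i A *v w = - (base j B *v w)"
    and bhw: "\<And>w. w \<in> W \<Longrightarrow> base j B *v (base i A *v w) = - w"
    by auto
  have Ai: "A *v coord i w = - coord i w" if "w \<in> W" for w
    using arg_cong[OF hw[OF that], of "coord i"] j by simp
  have fixed_zero: "w = 0" if w: "w \<in> W" and eq: "base l C *v w = w" and C: "C \<in> H"
    and neq: "mat_image (base l C) W \<noteq> W" for w l C
    using \<Gamma>_disjoint[OF \<Gamma>_base[OF C W] W _ w] mat_image_mem[OF w, of "base l C"] eq neq by metis
  have outside: "coord l w = 0" if w: "w \<in> W" and l: "l \<noteq> i" "l \<noteq> j" for w l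
  proof (rule ccontr)
    assume nz: "coord l w \<noteq> 0"
    \<comment> \<open>Neither matrix touches block \<open>l\<close>. A nonzero block there forces
      characteristic 2, so \<open>A\<close> fixes the \<open>i\<close>-th block and
      \<open>base i A\<close> fixes \<open>w\<close>, although it moves \<open>W\<close>.\<close>
    have "coord l w = - coord l w"
      using arg_cong[OF hw[OF w], of "coord l"] l by simp
    then have "A *v coord i w = coord i w"
      using Ai[OF w] eq_neg_vec nz by metis
    then have "base i A *v w = w"
      by (auto simp: vec_eq_coord)
    then show False
      using fixed_zero[OF w _ A moved] nz by auto
  qed
  have nonzero: "coord i w \<noteq> 0 \<and> coord j w \<noteq> 0" if w: "w \<in> W" "w \<noteq> 0" for w
  proof -
    have "base l C *v w = w" if "coord l w = 0" for l C
      using that by (auto simp: vec_eq_coord)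
    moreover have "base i A *v w \<noteq> w" "base j B *v w \<noteq> w"
      using fixed_zero[OF w(1)] w(2) A B moved bW by auto
    ultimately show ?thesis
      by blast
  qed
  have signs: "C *v coord i w = coord i w \<or> C *v coord i w = - coord i w"
    if C: "C \<in> H" and w: "w \<in> W" for C w
  proof -
    have "mat_image (base j B) W \<noteq> W"
      using bW moved by simp
    \<comment> \<open>The dichotomy with the two blocks exchanged: \<open>base j B\<close> is the
      moving element and \<open>C\<close> is arbitrary in \<open>H\<close>.\<close>
    from base_commutator_cases[OF W j B C this] w
    have "base i C *v w = w \<or> base j B *v w = - (base i C *v w)"
      by auto
    then show ?thesis
    proof
      assume "base i C *v w = w"
      from arg_cong[OF this, of "coord i"] show ?thesis
        by simp
    next
      assume "base j B *v w = - (base i C *v w)"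
      from arg_cong[OF this, of "coord i"] j show ?thesis
        by (metis coord_base coord_simps(4) minus_minus)
    qed
  qed
  show thesis
    using that[OF j outside nonzero Ai signs] by blast
qed


section \<open>The exceptional configuration\<close>

text \<open>All of \<open>H\<close> acts by signs on the \<open>i\<close>-th block \<open>u\<close>
  of a nonzero vector of \<open>W\<close>, so by irreducibility the line of \<open>u\<close> is the
  whole space; this determines \<open>CARD('d)\<close> and \<open>H\<close>. The pairs of blocks
  that support members of \<open>\<Gamma>\<close> give the pairing.\<close>

lemma exceptional_if_moved:
  assumes W: "W \<in> \<Gamma>" and A: "A \<in> H" and moved: "mat_image (base i A) W \<noteq> W"
  shows "CARD('d) = 1" "card H = 2" "even CARD('k) \<and> preserves_pairing K"
proof -
  obtain j where j: "j \<noteq> i"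
    and outside: "\<And>w l. w \<in> W \<Longrightarrow> l \<noteq> i \<Longrightarrow> l \<noteq> j \<Longrightarrow> coord l w = 0"
    and nonzero: "\<And>w. w \<in> W \<Longrightarrow> w \<noteq> 0 \<Longrightarrow> coord i w \<noteq> 0 \<and> coord j w \<noteq> 0"
    and Ai: "\<And>w. w \<in> W \<Longrightarrow> A *v coord i w = - coord i w"
    and signs: "\<And>B w. B \<in> H \<Longrightarrow> w \<in> W \<Longrightarrow> B *v coord i w = coord i w \<or> B *v coord i w = - coord i w"
    by (rule moved_member[OF assms]) blast
  obtain w0 where w0: "w0 \<in> W" "w0 \<noteq> 0"
    using \<Gamma>_nonzero_member[OF W] by blast
  define u where "u = coord i w0"
  have u: "u \<noteq> 0" "A *v u = - u" and u_signs: "\<And>B. B \<in> H \<Longrightarrow> B *v u = u \<or> B *v u = - u"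
    using nonzero[OF w0] Ai[OF w0(1)] signs[OF _ w0(1)] by (auto simp: u_def)
  have line: "\<exists>c. x = c *s u" for x
  proof -
    have "B *v x \<in> vec.span {u}" if B: "B \<in> H" and x: "x \<in> vec.span {u}" for B x
    proof -
      obtain c where "x = c *s u"
        using x by (auto simp: vec.span_singleton)
      then have "B *v x = c *s (B *v u)"
        by (simp add: vector_scalar_commute)
      moreover have "B *v u \<in> vec.span {u}"
        using u_signs[OF B] vec.span_base[of u "{u}"] vec.span_neg[of u "{u}"] by auto
      ultimately show ?thesis
        by (simp add: vec.span_scale)
    qed
    then have "vec.span {u} = {0} \<or> vec.span {u} = UNIV"
      by (intro H_invariant_subspace) auto
    moreover have "u \<in> vec.span {u}"
      by (simp add: vec.span_base)
    ultimately show ?thesis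
      using u by (auto simp: vec.span_singleton)
  qed
  show "CARD('d) = 1"
  proof -
    have "a = b" for a b :: 'd
    proof (rule ccontr)
      assume ab: "a \<noteq> b"
      obtain c c' where c: "axis a 1 = c *s u" "axis b 1 = c' *s u"
        using line by metis
      have "c * u $ a = 1" "c * u $ b = 0" "c' * u $ b = 1"
        using ab arg_cong[OF c(1), of "\<lambda>v. v $ a"] arg_cong[OF c(1), of "\<lambda>v. v $ b"]
          arg_cong[OF c(2), of "\<lambda>v. v $ b"]
        by (auto simp: axis_def)
      then show False
        by auto
    qed
    then have "UNIV = {undefined :: 'd}"
      by auto
    then show ?thesis
      by (metis card_1_singleton_iff One_nat_def)
  qed
  have scalar: "B = C" if "B *v u = C *v u" for B C :: "'a ^ 'd ^ 'd"
    unfolding matrix_eq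
  proof
    fix x
    obtain c where "x = c *s u"
      using line by blast
    then show "B *v x = C *v x"
      using that by (simp add: vector_scalar_commute)
  qed
  have A_neg: "A *v x = - x" for x
    using line[of x] u by (auto simp: vector_scalar_commute)
  \<comment> \<open>In characteristic 2 the matrix \<open>A\<close>, which acts as
    \<open>-1\<close>, would be the identity and could not move \<open>W\<close>.\<close>
  have neg: "x \<noteq> - x" if "x \<noteq> 0" for x :: "'a ^ 'd"
  proof
    assume "x = - x"
    then have eq: "y = - y" for y :: "'a ^ 'd"
      using eq_neg_vec \<open>x \<noteq> 0\<close> by blast
    then have "base i A *v v = v" for v
      using A_neg by (auto simp: vec_eq_coord)
    then show False
      using moved by (simp add: mat_image_def)
  qed
  show "card H = 2"
  proof -
    have "B = mat 1 \<or> B = A" if "B \<in> H" for B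
      using u_signs[OF that] scalar[of B "mat 1"] scalar[of B A] u by auto
    then have "H = {mat 1, A}"
      using A one_H by auto
    moreover have "A \<noteq> mat 1"
      using u neg[OF u(1)] by auto
    ultimately show ?thesis
      by simp
  qed
  \<comment> \<open>The last condition makes both block projections injective on \<open>W\<close>.
    No reference to a moving element is kept, so the relation is symmetric in \<open>a\<close> and
    \<open>b\<close> and is transported by \<open>K\<close>.\<close>
  define linked where "linked a b W \<longleftrightarrow> W \<in> \<Gamma> \<and> a \<noteq> b \<and>
    (\<forall>w\<in>W. \<forall>l. l \<noteq> a \<longrightarrow> l \<noteq> b \<longrightarrow> coord l w = 0) \<and>
    (\<forall>w\<in>W. w \<noteq> 0 \<longrightarrow> coord a w \<noteq> 0 \<and> coord b w \<noteq> 0)" for a b W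
  have linked_perm: "linked (\<sigma> a) (\<sigma> b) (mat_image (block_perm \<sigma>) W)"
    if \<sigma>: "\<sigma> \<in> K" and W: "linked a b W" for \<sigma> a b W
  proof -
    have bij: "bij \<sigma>"
      by (rule K_bij[OF \<sigma>])
    have coord: "coord (\<sigma> m) (block_perm \<sigma> *v w) = coord m w" for m w
      using bij by (simp add: coord_block_perm bij_is_inj)
    show ?thesis
      unfolding linked_def
    proof (intro conjI ballI allI impI)
      show "mat_image (block_perm \<sigma>) W \<in> \<Gamma>"
        using W \<sigma> by (simp add: linked_def \<Gamma>_mat_image block_perm_wreath)
      show "\<sigma> a \<noteq> \<sigma> b"
        using W bij by (simp add: linked_def bij_is_inj inj_eq)
    next
      fix v l
      assume v: "v \<in> mat_image (block_perm \<sigma>) W" and l: "l \<noteq> \<sigma> a" "l \<noteq> \<sigma> b"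
      obtain w where w: "w \<in> W" "v = block_perm \<sigma> *v w"
        using v by (auto simp: mat_image_def)
      obtain m where m: "l = \<sigma> m"
        using bij by (metis bij_pointE)
      then show "coord l v = 0"
        using l w W by (auto simp: linked_def coord)
    next
      fix v
      assume v: "v \<in> mat_image (block_perm \<sigma>) W" "v \<noteq> 0"
      then obtain w where w: "w \<in> W" "v = block_perm \<sigma> *v w"
        by (auto simp: mat_image_def)
      then have "w \<noteq> 0"
        using v by auto
      then show "coord (\<sigma> a) v \<noteq> 0" "coord (\<sigma> b) v \<noteq> 0"
        using W w by (auto simp: linked_def coord)
    qed
  qed
  have linked_unique: "b = b'" if L: "linked a b X" "linked a b' X'" for a b b' X X'
  proof (rule ccontr)
    assume neq: "b \<noteq> b'"
    have X: "X \<in> \<Gamma>" "X' \<in> \<Gamma>" and ab: "a \<noteq> b" "a \<noteq> b'"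
      using L by (auto simp: linked_def)
    obtain x0 x' where x0: "x0 \<in> X" "x0 \<noteq> 0" and x': "x' \<in> X'" "x' \<noteq> 0"
      using \<Gamma>_nonzero_member X by metis
    have nz: "coord a x0 \<noteq> 0" "coord a x' \<noteq> 0"
      using L x0 x' by (auto simp: linked_def)
    obtain c c' where c: "coord a x0 = c *s u" "coord a x' = c' *s u"
      using line by metis
    have c0: "c \<noteq> 0" "c' \<noteq> 0"
      using c nz by auto
    \<comment> \<open>Rescaling makes \<open>x\<close> and \<open>x'\<close> agree in block
      \<open>a\<close>, which is possible because all blocks are multiples of
      \<open>u\<close>.\<close>
    define x where "x = (c' / c) *s x0"
    have x: "x \<in> X" "x \<noteq> 0" "coord a x = coord a x'"
      using x0 c0 c by (auto simp: x_def vec.subspace_scale \<Gamma>_subspace X vector_smult_assoc)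
    have xb: "coord b x \<noteq> 0"
      using L x by (auto simp: linked_def)
    let ?h = "base a A"
    have hX: "mat_image ?h X \<in> \<Gamma>" "mat_image ?h X' \<in> \<Gamma>"
      using X A by (auto simp: \<Gamma>_base)
    have "mat_image ?h X \<noteq> X"
    proof
      assume "mat_image ?h X = X"
      \<comment> \<open>This difference vanishes in block \<open>b\<close>, hence is zero by
        linkedness; but \<open>A\<close> negates the nonzero block \<open>a\<close> of
        \<open>x\<close>.\<close>
      then have d: "?h *v x - x \<in> X"
        using x mat_image_mem[of x X ?h] by (intro vec.subspace_diff \<Gamma>_subspace X) auto
      have "coord b (?h *v x - x) = 0"
        using ab by simp
      then have "?h *v x - x = 0"
        using L d by (auto simp: linked_def)
      then have "coord a (?h *v x) = coord a x"
        by simp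
      then show False
        using A_neg[of "coord a x"] neg[of "coord a x"] nz x by simp
    qed
    \<comment> \<open>Both \<open>x - ?h *v x\<close> and \<open>x' - ?h *v x'\<close> are
      concentrated in block \<open>a\<close>, where they agree.\<close>
    moreover have eq: "x = ?h *v x + x' + - (?h *v x')"
      using x A_neg by (auto simp: vec_eq_coord)
    moreover have "- (?h *v x') \<in> mat_image ?h X'"
      by (intro vec.subspace_neg \<Gamma>_subspace hX mat_image_mem x')
    ultimately have "X = X' \<or> X = mat_image ?h X'"
      using internal_direct_sum_indep[OF \<Gamma>_direct X(1) hX(1) X(2) hX(2) _ _ _ x(1) _ x'(1)]
        mat_image_mem[OF x(1), of ?h] x(2) by metis
    \<comment> \<open>Block \<open>b\<close> vanishes on \<open>X'\<close> and on its image under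
      \<open>?h\<close>, but not at \<open>x\<close>, so \<open>X\<close> is neither of
      them.\<close>
    moreover have "coord b v = 0" if "v \<in> X'" for v
      using L that ab neq by (auto simp: linked_def)
    then have "coord b v = 0" if "v \<in> X' \<or> v \<in> mat_image ?h X'" for v
      using that ab by (auto simp: mat_image_def)
    ultimately show False
      using x xb by blast
  qed
  show "even CARD('k) \<and> preserves_pairing K"
  proof (rule even_card_preserves_pairing[of "\<lambda>a b. \<exists>W. linked a b W"])
    show "\<exists>b W. linked a b W" for a
    proof -
      obtain \<sigma> where \<sigma>: "\<sigma> \<in> K" "\<sigma> i = a"
        using K_transitive by (auto simp: transitive_perms_def)
      have "linked i j W"
        using W j outside nonzero by (auto simp: linked_def)
      from linked_perm[OF \<sigma>(1) this] show ?thesis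
        using \<sigma>(2) by blast
    qed
    show "b = b'" if "\<exists>W. linked a b W" "\<exists>W. linked a b' W" for a b b'
      using that linked_unique by blast
    show "\<nexists>W. linked a a W" for a
      by (simp add: linked_def)
    show "\<exists>W. linked b a W" if "\<exists>W. linked a b W" for a b
      using that by (auto simp: linked_def)
    show "\<exists>W. linked (\<sigma> a) (\<sigma> b) W" if "\<sigma> \<in> K" "\<exists>W. linked a b W" for \<sigma> a b
      using that linked_perm by blast
  qed
qed

section \<open>Systems stabilised by the base group\<close>

text \<open>Since \<open>\<Gamma>\<close> spans, some member contains a vector moved by a given
  nontrivial \<open>base i A\<close>, hence a nonzero vector of \<open>summand i\<close>, hence all
  of it. Grouping the blocks of a vector by the member containing each summand then splits every
  member into summands.\<close>

lemma summands_refine: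
  assumes fixed: "\<And>i A W. A \<in> H \<Longrightarrow> W \<in> \<Gamma> \<Longrightarrow> mat_image (base i A) W = W"
    and card: "CARD('k) > 1"
  shows "refinement (wreath H K) (range summand) \<Gamma>"
proof -
  have inv: "base i A *v w \<in> W" if "A \<in> H" "W \<in> \<Gamma>" "w \<in> W" for i A W w
    using mat_image_mem[OF that(3)] fixed[OF that(1,2)] by blast
  have "\<exists>W\<in>\<Gamma>. summand i \<subseteq> W" for i
  proof -
    have "coord i (emb i 1 :: 'a ^ ('k \<times> 'd)) \<noteq> 0"
      by (simp add: vec_eq_iff)
    then obtain A where A: "A \<in> H" "base i A *v emb i 1 \<noteq> emb i 1"
      using exists_base_moving by blast
    have "\<exists>W\<in>\<Gamma>. \<exists>w\<in>W. base i A *v w \<noteq> w"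
    proof (rule ccontr)
      let ?F = "{v. base i A *v v = v}"
      assume "\<not> ?thesis"
      then have "\<Union>\<Gamma> \<subseteq> ?F"
        by auto
      moreover have "vec.subspace ?F"
        by (auto simp: vec.subspace_def matrix_vector_right_distrib vector_scalar_commute)
      ultimately have "vec.span (\<Union>\<Gamma>) \<subseteq> ?F"
        by (rule vec.span_minimal)
      then show False
        using A unfolding \<Gamma>_span by blast
    qed
    then obtain W w where w: "W \<in> \<Gamma>" "w \<in> W" "base i A *v w \<noteq> w"
      by blast
    have "base i A *v w - w \<in> W"
      using A w by (intro vec.subspace_diff \<Gamma>_subspace inv)
    then have "summand i \<subseteq> W"
      using w inv base_diff_mem_summand
      by (intro summand_subset[OF \<Gamma>_subspace, of _ _ "base i A *v w - w"]) auto
    then show ?thesis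
      using w by blast
  qed
  then obtain c where c: "\<And>i. c i \<in> \<Gamma>" "\<And>i. summand i \<subseteq> c i"
    by metis
  have "\<exists>S\<subseteq>range summand. internal_direct_sum S W" if W: "W \<in> \<Gamma>" for W
  proof -
    let ?S = "{X \<in> range summand. X \<subseteq> W}"
    have "vec.span (\<Union>?S) = W"
    proof
      show "vec.span (\<Union>?S) \<subseteq> W"
        by (rule vec.span_minimal) (auto simp: \<Gamma>_subspace W)
      show "W \<subseteq> vec.span (\<Union>?S)"
      proof
        fix w
        assume w: "w \<in> W"
        define f where "f X = (\<Sum>i\<in>{i \<in> UNIV. c i = X}. emb i (coord i w))" for X
        have f: "f X \<in> X" if "X \<in> \<Gamma>" for X
          unfolding f_def using subsetD[OF c(2) emb_mem_summand] by (intro vec.subspace_sum \<Gamma>_subspace that) auto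
        have "(\<Sum>X\<in>\<Gamma>. f X) = (\<Sum>i\<in>UNIV. emb i (coord i w))"
          unfolding f_def using c by (intro sum.group \<Gamma>_finite) auto
        then have "(\<Sum>X\<in>\<Gamma>. f X) = w"
          by (simp add: sum_emb_coord)
        \<comment> \<open>\<open>f\<close> and the family with the single entry \<open>w\<close> at
          \<open>W\<close> are two decompositions of \<open>w\<close> along \<open>\<Gamma>\<close>;
          their difference \<open>g\<close> vanishes, so \<open>w\<close> uses only the blocks
          inside \<open>W\<close>.\<close>
        define g where "g X = f X - (if X = W then w else 0)" for X
        have "(\<Sum>X\<in>\<Gamma>. g X) = 0"
          unfolding g_def using \<open>(\<Sum>X\<in>\<Gamma>. f X) = w\<close> W \<Gamma>_finite by (simp add: sum_subtractf)
        moreover have "\<forall>X\<in>\<Gamma>. g X \<in> X"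
          unfolding g_def using f w
          by (intro ballI vec.subspace_diff \<Gamma>_subspace) (auto simp: vec.subspace_0 \<Gamma>_subspace)
        moreover have "(\<forall>X\<in>\<Gamma>. g X \<in> X) \<and> (\<Sum>X\<in>\<Gamma>. g X) = 0 \<longrightarrow> (\<forall>X\<in>\<Gamma>. g X = 0)"
          using \<Gamma>_direct unfolding internal_direct_sum_def by (elim conjE allE[of _ g])
        ultimately have "g W = 0"
          using W by blast
        then have "w = (\<Sum>i\<in>{i \<in> UNIV. c i = W}. emb i (coord i w))"
          by (simp add: g_def f_def)
        moreover have "\<dots> \<in> vec.span (\<Union>?S)"
        proof (intro vec.span_sum vec.span_base)
          fix l
          assume "l \<in> {i \<in> UNIV. c i = W}"
          then have "summand l \<in> ?S"
            using c(2)[of l] by auto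
          then show "emb l (coord l w) \<in> \<Union>?S"
            by (rule UnionI) simp
        qed
        ultimately show "w \<in> vec.span (\<Union>?S)"
          by simp
      qed
    qed
    moreover have "internal_direct_sum ?S (vec.span (\<Union>?S))"
      by (rule internal_direct_sum_subset[OF internal_direct_sum_summands]) auto
    ultimately show ?thesis
      by (intro exI[of _ ?S]) auto
  qed
  then show ?thesis
    unfolding refinement_def using summands_system[OF card] by blast
qed

end

section \<open>Existence and uniqueness of the nonrefinable system\<close>

theorem theorem1p1:
  fixes H :: "('a::field ^ 'd ^ 'd) set"
    and K :: "('k::finite \<Rightarrow> 'k) set"
  assumes "CARD('k) > 1"
    and "H \<noteq> {mat 1}"
    and "irreducible_group H"
    and "primitive_group H"
    and "subgroup K (BijGroup UNIV)"
    and "transitive_perms K"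
  shows "irreducible_group (wreath H K) \<and>
    (\<not> (CARD('d) = 1 \<and> even CARD('k) \<and> card H = 2 \<and> preserves_pairing K) \<longrightarrow>
       (\<exists>!\<Gamma>. nonrefinable_system (wreath H K) \<Gamma>))"
proof (intro conjI impI)
  interpret wreath_data H K
    by (intro wreath_data.intro assms)
  show "irreducible_group (wreath H K)"
    by (rule irreducible_wreath)
  assume not_exceptional: "\<not> (CARD('d) = 1 \<and> even CARD('k) \<and> card H = 2 \<and> preserves_pairing K)"
  \<comment> \<open>The summands are the finest system: antisymmetry makes them nonrefinable, and
    any nonrefinable system must equal them.\<close>
  have refines: "refinement (wreath H K) (range summand) \<Gamma>"
    if "system_of_imprimitivity (wreath H K) \<Gamma>" for \<Gamma>
  proof -
    interpret wreath_system H K \<Gamma>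
      by (intro wreath_system.intro wreath_system_axioms.intro wreath_data_axioms assms that)
    show ?thesis
      using exceptional_if_moved not_exceptional assms(1) by (intro summands_refine) blast+
  qed
  show "\<exists>!\<Gamma>. nonrefinable_system (wreath H K) \<Gamma>"
  proof (rule ex1I)
    have "\<Delta> = range summand" if \<Delta>: "refinement (wreath H K) \<Delta> (range summand)" for \<Delta>
    proof -
      have "system_of_imprimitivity (wreath H K) \<Delta>"
        using \<Delta> by (simp add: refinement_def)
      then show ?thesis
        by (rule refinement_antisym[OF \<Delta> refines])
    qed
    then show "nonrefinable_system (wreath H K) (range summand)"
      unfolding nonrefinable_system_def using summands_system[OF assms(1)] by blast
    show "\<Gamma> = range summand" if "nonrefinable_system (wreath H K) \<Gamma>" for \<Gamma>
      using that refines[of \<Gamma>] unfolding nonrefinable_system_def by blast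
  qed
qed

end
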